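(* Let $\phi$ be a CNF formula, let $\{X,Y\}$ be a partition of $\mathrm{vars}(\phi)$, and let $\mathrm{pr}: Y\to[0,1]$ be a probability mapping. Run the following algorithm on $(\phi,\mathrm{pr})$. (1) Choose any $(X,Y)$-graded project-join tree $\mathcal{T}=(T,r,\gamma,\pi)$ for $\phi$, and let $\sigma$ be an empty stack. (2) Compute $\mathrm{Valuator}(r)$, where $\mathrm{Valuator}(v)$ is defined recursively. If $v$ is a leaf, it returns $[\gamma(v)]$. If $v$ is an internal node, it first sets $f:=\prod_{v'\in C(v)}\mathrm{Valuator}(v')$. Then it goes through the variables $x\in\pi(v)$ one by one, in any order. For each such $x$: if $x\in X$, it pushes the derivative sign $\mathrm{dsgn}_x f$ onto $\sigma$ and sets $f:=\exists_x f$; otherwise ($x\in Y$) it sets $f:=\mathcal{R}^{\mathrm{pr}(x)}_x f$. Finally it returns $f$. (3) Set $m:=\mathrm{Valuator}(r)(\emptyset)$ and $\tau:=\emptyset$. (4) While $\sigma$ is nonempty: pop $g=\mathrm{dsgn}_x f$ from $\sigma$ and set $\tau:=\tau\cup g(\tau|_{\mathrm{dom}(g)})$. (5) Output $(m,\tau)$. Then $m$ is the maximum of the pseudo-Boolean function $[\mathcal{R}^{\mathrm{pr}}_Y \phi]=\mathcal{R}^{\mathrm{pr}}_Y[\phi]$, i.e. $m=(\exists_X\mathcal{R}^{\mathrm{pr}}_Y[\phi])(\emptyset)$. Moreover, $\tau$ is a truth assignment for $X$ that is a maximizer of $\mathcal{R}^{\mathrm{pr}}_Y[\phi]$. In other words,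 the algorithm solves exist-random stochastic satisfiability (ER-SSAT) on $\exists X\,\mathcal{R}^{\mathrm{pr}} Y\,\phi$.
   Context: Variables are binary and $\mathbb{B}=\{0,1\}$. A truth assignment for a set $S$ of variables is a function $S\to\mathbb{B}$; $2^S$ denotes the set of these. For a function $f$ and a set $S$, the restriction is $f|_S$. A pseudo-Boolean (PB) function over $X$ is a map $f:2^X\to\mathbb{R}$, and we write $\mathrm{vars}(f)=X$. Join: for $f:2^X\to\mathbb{R}$ and $g:2^Y\to\mathbb{R}$, the join is $(f\cdot g)(\tau)=f(\tau|_X)\,g(\tau|_Y)$ for $\tau\in 2^{X\cup Y}$. Existential projection: $(\exists_x f)(\tau)=\max(f(\tau\cup\{x\mapsto0\}),f(\tau\cup\{x\mapsto1\}))$ for $\tau\in 2^{X\setminus\{x\}}$. Random projection with probability $p\in[0,1]$: $(\mathcal{R}^p_x f)(\tau)=p\,f(\tau\cup\{x\mapsto1\})+(1-p)\,f(\tau\cup\{x\mapsto0\})$. For a set $S$ of variables, $\exists_S$ means applying $\exists_x$ for all $x\in S$. Given a probability mapping $\mathrm{pr}$ (a function from variables to $[0,1]$), $\mathcal{R}^{\mathrm{pr}}_S$ means applying $\mathcal{R}^{\mathrm{pr}(x)}_x$ for all $x\in S$. Both operations are order-independent, and $\exists_\emptyset f=\mathcal{R}_\emptyset f=f$. The maximum of $f:2^X\to\mathbb{R}$ is $(\exists_X f)(\emptyset)$. A maximizer of $f$ is a $\tau\in 2^X$ with $f(\tau)$ equal to the maximum. Derivative sign: $\mathrm{dsgn}_x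 f$ is the function on $2^{X\setminus\{x\}}$ with $(\mathrm{dsgn}_x f)(\tau)=\{x\mapsto1\}$ if $f(\tau\cup\{x\mapsto1\})\ge f(\tau\cup\{x\mapsto0\})$, and $\{x\mapsto0\}$ otherwise. Its domain set is $\mathrm{dom}(\mathrm{dsgn}_x f)=X\setminus\{x\}$, and $g(\tau|_{\mathrm{dom}(g)})$ denotes evaluating it on the restriction. A CNF formula $\phi$ is a set of clauses. $[\psi]$ denotes the Boolean (0/1-valued) function of a formula $\psi$ over its variables $\mathrm{vars}(\psi)$, so $[\phi]=\prod_{c\in\phi}[c]$. In a rooted tree $(T,r)$, the children $C(v)$ of $v$ are its neighbours $v'$ whose path to $r$ passes through $v$. A leaf is a non-root node of degree one; $\mathcal{L}(T)$ is the set of leaves; the other nodes (including $r$) are internal. A project-join tree for $\phi$ is $(T,r,\gamma,\pi)$ where: - $(T,r)$ is a rooted tree; - $\gamma:\mathcal{L}(T)\to\phi$ is a bijection; - $\pi$ maps internal nodes to subsets of $\mathrm{vars}(\phi)$; - $\{\pi(v)\}_{v\text{ internal}}$ is a partition of $\mathrm{vars}(\phi)$, where some $\pi(v)$ may be empty; - for every internal $v$, every $x\in\pi(v)$ and every clause $c$ with $x\in\mathrm{vars}(c)$, the leaf $\gamma^{-1}(c)$ is a descendant of $v$. The tree is $(X,Y)$-graded if the internal nodes can be partitioned into $\mathcal{I}_X$ and $\mathcal{I}_Y$ such that: - $\pi(v)\subseteq X$ for $v\in\mathcal{I}_X$; - $\pi(v)\subseteq Y$ for $v\in\mathcal{I}_Y$;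 - no node of $\mathcal{I}_X$ is a descendant of a node of $\mathcal{I}_Y$. *)

theory Defs
  imports
    Complex_Main
    "HOL-Library.Disjoint_Sets"
    "Graph_Theory.Digraph_Component"
begin

section \<open>Pseudo-Boolean functions\<close>

text \<open>
  A truth assignment for \<open>S\<close> is a partial map with domain \<open>S\<close>; restriction is \<open>|`\<close>,
  the union of assignments with disjoint domains is \<open>++\<close>, and the empty assignment is
  \<^const>\<open>Map.empty\<close>.
\<close>

type_synonym 'v assignment = "'v \<rightharpoonup> bool"

definition assignments :: "'v set \<Rightarrow> 'v assignment set" where
  "assignments S = {\<tau>. dom \<tau> = S}"

text \<open>
  A pseudo-Boolean function over \<open>X\<close> carries its variable set \<open>X\<close>. Only the values of
  \<open>pb_val\<close> on \<open>assignments X\<close> are meaningful.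
\<close>

record 'v pbf =
  pb_vars :: "'v set"
  pb_val :: "'v assignment \<Rightarrow> real"

definition pb_join :: "'v pbf \<Rightarrow> 'v pbf \<Rightarrow> 'v pbf" where
  "pb_join f g =
    \<lparr>pb_vars = pb_vars f \<union> pb_vars g,
     pb_val = (\<lambda>\<tau>. pb_val f (\<tau> |` pb_vars f) * pb_val g (\<tau> |` pb_vars g))\<rparr>"

definition pb_one :: "'v pbf" where
  "pb_one = \<lparr>pb_vars = {}, pb_val = (\<lambda>_. 1)\<rparr>"

definition exist_proj :: "'v \<Rightarrow> 'v pbf \<Rightarrow> 'v pbf" where
  "exist_proj x f =
    \<lparr>pb_vars = pb_vars f - {x},
     pb_val = (\<lambda>\<tau>. max (pb_val f (\<tau>(x \<mapsto> False))) (pb_val f (\<tau>(x \<mapsto> True))))\<rparr>"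

definition random_proj :: "real \<Rightarrow> 'v \<Rightarrow> 'v pbf \<Rightarrow> 'v pbf" where
  "random_proj p x f =
    \<lparr>pb_vars = pb_vars f - {x},
     pb_val = (\<lambda>\<tau>. p * pb_val f (\<tau>(x \<mapsto> True)) + (1 - p) * pb_val f (\<tau>(x \<mapsto> False)))\<rparr>"

text \<open>
  Projections of distinct variables commute, so iterating them over a finite set with
  \<^const>\<open>Finite_Set.fold\<close> does not depend on the order.
\<close>

lemma exist_proj_commute: "comp_fun_commute exist_proj"
proof
  fix x y :: 'v
  show "exist_proj y \<circ> exist_proj x = exist_proj x \<circ> exist_proj y"
    by (cases "x = y")
      (auto simp: exist_proj_def fun_eq_iff fun_upd_twist max.assoc max.left_commute)
qed

lemma random_proj_commute:
  fixes pr :: "'v \<Rightarrow> real"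
  shows "comp_fun_commute (\<lambda>x. random_proj (pr x) x)"
proof
  fix x y :: 'v
  show "random_proj (pr y) y \<circ> random_proj (pr x) x = random_proj (pr x) x \<circ> random_proj (pr y) y"
    by (cases "x = y")
      (auto simp: random_proj_def fun_eq_iff fun_upd_twist algebra_simps)
qed

definition exist_projs :: "'v set \<Rightarrow> 'v pbf \<Rightarrow> 'v pbf" where
  "exist_projs S f = Finite_Set.fold exist_proj f S"

definition random_projs :: "('v \<Rightarrow> real) \<Rightarrow> 'v set \<Rightarrow> 'v pbf \<Rightarrow> 'v pbf" where
  "random_projs pr S f = Finite_Set.fold (\<lambda>x. random_proj (pr x) x) f S"

definition pb_maximum :: "'v pbf \<Rightarrow> real" where
  "pb_maximum f = pb_val (exist_projs (pb_vars f) f) Map.empty"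

definition is_maximizer :: "'v pbf \<Rightarrow> 'v assignment \<Rightarrow> bool" where
  "is_maximizer f \<tau> \<longleftrightarrow> \<tau> \<in> assignments (pb_vars f) \<and> pb_val f \<tau> = pb_maximum f"

text \<open>
  A derivative sign is a pair \<open>(D, g)\<close> of its domain set \<open>D\<close> and a function \<open>g\<close> mapping
  assignments for \<open>D\<close> to singleton assignments.
\<close>

type_synonym 'v dsign = "'v set \<times> ('v assignment \<Rightarrow> 'v assignment)"

definition dsgn :: "'v \<Rightarrow> 'v pbf \<Rightarrow> 'v dsign" where
  "dsgn x f =
    (pb_vars f - {x},
     \<lambda>\<tau>. if pb_val f (\<tau>(x \<mapsto> True)) \<ge> pb_val f (\<tau>(x \<mapsto> False)) then [x \<mapsto> True] else [x \<mapsto> False])"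


section \<open>CNF formulas\<close>

datatype 'v literal = Pos 'v | Neg 'v

type_synonym 'v clause = "'v literal set"
type_synonym 'v cnf = "'v clause set"

fun lit_var :: "'v literal \<Rightarrow> 'v" where
  "lit_var (Pos x) = x"
| "lit_var (Neg x) = x"

fun lit_holds :: "'v assignment \<Rightarrow> 'v literal \<Rightarrow> bool" where
  "lit_holds \<tau> (Pos x) \<longleftrightarrow> \<tau> x = Some True"
| "lit_holds \<tau> (Neg x) \<longleftrightarrow> \<tau> x = Some False"

definition clause_vars :: "'v clause \<Rightarrow> 'v set" where
  "clause_vars c = lit_var ` c"

definition cnf_vars :: "'v cnf \<Rightarrow> 'v set" where
  "cnf_vars \<phi> = (\<Union>c\<in>\<phi>. clause_vars c)"

definition is_cnf :: "'v cnf \<Rightarrow> bool" where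
  "is_cnf \<phi> \<longleftrightarrow> finite \<phi> \<and> (\<forall>c\<in>\<phi>. finite c)"

definition clause_pb :: "'v clause \<Rightarrow> 'v pbf" where
  "clause_pb c =
    \<lparr>pb_vars = clause_vars c, pb_val = (\<lambda>\<tau>. of_bool (\<exists>l\<in>c. lit_holds \<tau> l))\<rparr>"

definition cnf_pb :: "'v cnf \<Rightarrow> 'v pbf" where
  "cnf_pb \<phi> =
    \<lparr>pb_vars = cnf_vars \<phi>, pb_val = (\<lambda>\<tau>. of_bool (\<forall>c\<in>\<phi>. \<exists>l\<in>c. lit_holds \<tau> l))\<rparr>"


section \<open>Graded project-join trees\<close>

text \<open>
  Undirected graphs are symmetric loop-free digraphs. In these, an edge traversed back and
  forth is a (directed) cycle of length two, so acyclicity only excludes cycles of length at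
  least three. This is also why \<^const>\<open>tree\<close>, which is about directed cycles, cannot be
  used here.
\<close>

definition undirected_tree :: "'n pair_pre_digraph \<Rightarrow> bool" where
  "undirected_tree G \<longleftrightarrow>
    pair_graph G \<and> connected (with_proj G) \<and>
    \<not> (\<exists>p. pre_digraph.cycle (with_proj G) p \<and> length p \<ge> 3)"

text \<open>
  The components of \<open>(T, r, \<gamma>, \<pi>)\<close>; \<open>\<gamma>\<close> is relevant on leaves only and \<open>\<pi>\<close> on internal
  nodes only.
\<close>

record ('n, 'v) pj_tree =
  pj_graph :: "'n pair_pre_digraph"
  pj_root :: 'n
  pj_clause :: "'n \<Rightarrow> 'v clause"
  pj_proj :: "'n \<Rightarrow> 'v set"

definition neighbours :: "('n, 'v) pj_tree \<Rightarrow> 'n \<Rightarrow> 'n set" where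
  "neighbours T v = {w. (v, w) \<in> parcs (pj_graph T)}"

definition children :: "('n, 'v) pj_tree \<Rightarrow> 'n \<Rightarrow> 'n set" where
  "children T v =
    {w \<in> neighbours T v.
      \<exists>p. pre_digraph.apath (with_proj (pj_graph T)) w p (pj_root T) \<and>
          v \<in> set (pre_digraph.awalk_verts (with_proj (pj_graph T)) w p)}"

definition descendant :: "('n, 'v) pj_tree \<Rightarrow> 'n \<Rightarrow> 'n \<Rightarrow> bool" where
  "descendant T w v \<longleftrightarrow> (v, w) \<in> {(a, b). b \<in> children T a}\<^sup>+"

definition leaves :: "('n, 'v) pj_tree \<Rightarrow> 'n set" where
  "leaves T = {v \<in> pverts (pj_graph T). v \<noteq> pj_root T \<and> card (neighbours T v) = 1}"

definition internals :: "('n, 'v) pj_tree \<Rightarrow> 'n set" where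
  "internals T = pverts (pj_graph T) - leaves T"

definition project_join_tree :: "'v cnf \<Rightarrow> ('n, 'v) pj_tree \<Rightarrow> bool" where
  "project_join_tree \<phi> T \<longleftrightarrow>
    undirected_tree (pj_graph T) \<and> pj_root T \<in> pverts (pj_graph T) \<and>
    bij_betw (pj_clause T) (leaves T) \<phi> \<and>
    disjoint_family_on (pj_proj T) (internals T) \<and>
    (\<Union>v\<in>internals T. pj_proj T v) = cnf_vars \<phi> \<and>
    (\<forall>v\<in>internals T. \<forall>x\<in>pj_proj T v. \<forall>c\<in>\<phi>. x \<in> clause_vars c \<longrightarrow>
      descendant T (the_inv_into (leaves T) (pj_clause T) c) v)"

definition graded :: "'v set \<Rightarrow> 'v set \<Rightarrow> ('n, 'v) pj_tree \<Rightarrow> bool" where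
  "graded X Y T \<longleftrightarrow>
    (\<exists>IX IY. IX \<union> IY = internals T \<and> IX \<inter> IY = {} \<and>
      (\<forall>v\<in>IX. pj_proj T v \<subseteq> X) \<and>
      (\<forall>v\<in>IY. pj_proj T v \<subseteq> Y) \<and>
      (\<forall>v\<in>IX. \<forall>w\<in>IY. \<not> descendant T v w))"


section \<open>The algorithm\<close>

text \<open>Stacks are lists whose head is the top element.\<close>

fun project_step ::
  "'v set \<Rightarrow> ('v \<Rightarrow> real) \<Rightarrow> 'v \<Rightarrow> 'v pbf \<times> 'v dsign list \<Rightarrow> 'v pbf \<times> 'v dsign list" where
  "project_step X pr x (f, \<sigma>) =
    (if x \<in> X then (exist_proj x f, dsgn x f # \<sigma>) else (random_proj (pr x) x f, \<sigma>))"

text \<open>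
  \<open>valuator X pr T v \<sigma> f \<sigma>'\<close>: the call \<open>Valuator(v)\<close>, started with stack \<open>\<sigma>\<close>, may return
  \<open>f\<close> and leave the stack \<open>\<sigma>'\<close>. The relation is nondeterministic, since the children and the
  variables of a node may be processed in any order; the lists \<open>vs\<close> and \<open>xs\<close> are the chosen
  orders. \<open>valuators\<close> evaluates a list of nodes from left to right, threading the stack.
\<close>

inductive
  valuator :: "'v set \<Rightarrow> ('v \<Rightarrow> real) \<Rightarrow> ('n, 'v) pj_tree \<Rightarrow>
    'n \<Rightarrow> 'v dsign list \<Rightarrow> 'v pbf \<Rightarrow> 'v dsign list \<Rightarrow> bool" and
  valuators :: "'v set \<Rightarrow> ('v \<Rightarrow> real) \<Rightarrow> ('n, 'v) pj_tree \<Rightarrow>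
    'n list \<Rightarrow> 'v dsign list \<Rightarrow> 'v pbf list \<Rightarrow> 'v dsign list \<Rightarrow> bool"
  for X pr T where
  leaf:
    "v \<in> leaves T \<Longrightarrow> valuator X pr T v \<sigma> (clause_pb (pj_clause T v)) \<sigma>"
| internal:
    "\<lbrakk>v \<in> internals T;
      distinct vs; set vs = children T v; valuators X pr T vs \<sigma> fs \<sigma>';
      distinct xs; set xs = pj_proj T v;
      fold (project_step X pr) xs (foldr pb_join fs pb_one, \<sigma>') = (f, \<sigma>'')\<rbrakk>
     \<Longrightarrow> valuator X pr T v \<sigma> f \<sigma>''"
| Nil:
    "valuators X pr T [] \<sigma> [] \<sigma>"
| Cons:
    "\<lbrakk>valuator X pr T v \<sigma> f \<sigma>'; valuators X pr T vs \<sigma>' fs \<sigma>''\<rbrakk>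
     \<Longrightarrow> valuators X pr T (v # vs) \<sigma> (f # fs) \<sigma>''"

text \<open>
  The loop that pops the stack. The result is \<^const>\<open>None\<close> if some derivative sign would be
  evaluated at an assignment that does not cover its domain set.
\<close>

fun unwind :: "'v dsign list \<Rightarrow> 'v assignment \<Rightarrow> 'v assignment option" where
  "unwind [] \<tau> = Some \<tau>"
| "unwind ((D, g) # \<sigma>) \<tau> = (if D \<subseteq> dom \<tau> then unwind \<sigma> (\<tau> ++ g (\<tau> |` D)) else None)"

text \<open>
  All possible outcomes of runs with the tree \<open>T\<close>. The outcome \<^const>\<open>None\<close> means that a
  function was evaluated outside its domain: either the root function, which is evaluated at
  the empty assignment, or a derivative sign.
\<close>

definition er_ssat_outcomes ::
  "'v set \<Rightarrow> ('v \<Rightarrow> real) \<Rightarrow> ('n, 'v) pj_tree \<Rightarrow> (real \<times> 'v assignment) option set" where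
  "er_ssat_outcomes X pr T =
    {if pb_vars f = {} then map_option (Pair (pb_val f Map.empty)) (unwind \<sigma> Map.empty) else None
     | f \<sigma>. valuator X pr T (pj_root T) [] f \<sigma>}"

end

theory Submission
  imports Defs
begin

text \<open>
  Let \<open>P\<close> be the set of variables projected in the subtree of a node \<open>v\<close>, and \<open>\<phi>\<close> the clauses at its
  leaves. The function \<open>f\<close> returned by \<open>Valuator(v)\<close> satisfies \<open>f \<tau> = max\<^sub>\<rho> H (\<tau> ++ \<rho>)\<close>, where
  \<open>H\<close> is \<open>[\<phi>]\<close> with the variables in \<open>P \<inter> Y\<close> randomly projected and \<open>\<rho>\<close> ranges over the assignments
  for \<open>P \<inter> X\<close>; moreover, popping the stack segment pushed by the call, starting from \<open>\<tau>\<close>,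
  produces a \<open>\<rho>\<close> that attains the maximum. At a join the subtrees of distinct children share neither
  projected variables nor projected variables with clauses, so \<open>H\<close> factorises and, being nonnegative,
  its maximum does too. Gradedness ensures that a random projection is only ever applied when
  \<open>P \<inter> X = {}\<close>, so that no maximum has to be exchanged with an expectation. The invariant at the
  root is the theorem.
\<close>

section \<open>Rooted trees\<close>

locale rooted_tree =
  fixes T :: "('n, 'v) pj_tree"
  assumes undirected_tree: "undirected_tree (pj_graph T)"
    and root_in_verts: "pj_root T \<in> pverts (pj_graph T)"
begin

abbreviation "G \<equiv> pj_graph T"
abbreviation "r \<equiv> pj_root T"

sublocale pair_graph G
  using undirected_tree by (simp add: undirected_tree_def)

text \<open>Two such paths to the root close up to a cycle through \<open>w\<close>.\<close>

lemma parent_unique: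
  assumes "(w, u) \<in> parcs G" "awalk u p r" "w \<notin> set (awalk_verts u p)"
    and "(w, v) \<in> parcs G" "awalk v q r" "w \<notin> set (awalk_verts v q)"
  shows "u = v"
proof (rule ccontr)
  assume neq: "u \<noteq> v"
  have walk: "awalk u (p @ rev_path q) v"
    using assms by auto
  have avoid: "w \<notin> set (awalk_verts u (p @ rev_path q))"
    using assms by (subst set_awalk_verts_append[where v = r and w = v])
      (auto simp: awalk_verts_rev_path)
  \<comment> \<open>Shortening the walk to a path makes its vertices distinct. It only reuses arcs
    of the walk, so \<open>w\<close> is still avoided.\<close>
  define s where "s = awalk_to_apath (p @ rev_path q)"
  have s: "apath u s v"
    using apath_awalk_to_apath[OF walk] by (simp add: s_def)
  have "set s \<subseteq> set (p @ rev_path q)"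
    using awalk_to_apath_subset[OF walk] by (simp add: s_def)
  then have "set (awalk_verts u s) \<subseteq> set (awalk_verts u (p @ rev_path q))"
    using set_awalk_verts[OF walk] set_awalk_verts[OF awalkI_apath[OF s]] by auto
  with avoid have w: "w \<notin> set (awalk_verts u s)" by blast
  let ?c = "(w, u) # s @ [(v, w)]"
  have "awalk v [(v, w)] w"
    using assms by (auto simp: awalk_simps arcs_symmetric intro: in_arcsD1)
  with awalkI_apath[OF s] have walk': "awalk u (s @ [(v, w)]) w"
    by (rule awalk_appendI)
  have "awalk w ?c w"
  proof -
    from walk' show ?thesis using assms(1) by (simp del: awalk_append_iff add: awalk_Cons_iff)
  qed
  moreover have "distinct (tl (awalk_verts w ?c))"
  proof -
    from walk' have "awalk_verts u (s @ [(v, w)]) = awalk_verts u s @ [w]"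
      by (subst awalk_verts_append) auto
    then show ?thesis using s w by (auto simp: apath_def)
  qed
  ultimately have "cycle ?c"
    unfolding cycle_def by blast
  \<comment> \<open>\<open>u\<close> and \<open>v\<close> differ, so \<open>s\<close> is nonempty.
    The bound 3 matters because an edge walked back and forth is a cycle of length 2.\<close>
  moreover have "length ?c \<ge> 3"
    using s neq by (cases s) (auto simp: apath_simps)
  ultimately show False
    using undirected_tree unfolding undirected_tree_def by blast
qed

text \<open>Cutting the path from \<open>w\<close> to the root at \<open>v\<close> leaves a walk
  from \<open>v\<close> that avoids \<open>w\<close>, since vertices do not repeat on a path. This
  is the form in which \<open>parent_unique\<close> applies.\<close>

lemma childrenE:
  assumes "w \<in> children T v"
  obtains p where "(v, w) \<in> parcs G" "(w, v) \<in> parcs G" "awalk v p r" "w \<notin> set (awalk_verts v p)" "w \<noteq> r"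
proof -
  from assms obtain p where arc: "(v, w) \<in> parcs G" and p: "apath w p r" "v \<in> set (awalk_verts w p)"
    by (auto simp: children_def neighbours_def)
  then obtain q q' where q: "p = q @ q'" "awalk w q v" "awalk v q' r"
    using awalk_decomp[OF awalkI_apath[OF p(1)] p(2)] by blast
  have neq: "v \<noteq> w" using arc no_loops' by blast
  with q have "q \<noteq> []" by (auto simp: awalk_simps)
  then obtain e q'' where e: "q = e # q''" by (cases q) auto
  have "w \<notin> set (awalk_verts v q')"
  proof -
    have "awalk (snd e) q'' v" using q e by (auto simp: awalk_simps)
    then have "set (awalk_verts v q') \<subseteq> set (awalk_verts (snd e) (q'' @ q'))"
      using q by (subst set_awalk_verts_append[where v = v and w = r]) auto
    moreover have "w \<notin> set (awalk_verts (snd e) (q'' @ q'))"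
      using p(1) q(1) e by (auto simp: apath_Cons_iff)
    ultimately show ?thesis by blast
  qed
  moreover from this q have "w \<noteq> r"
    by (metis awalkE awalk_verts_non_Nil last_in_set)
  ultimately show thesis
    using that arc q arcs_symmetric by blast
qed

lemma childI:
  assumes "(w, v) \<in> parcs G" "apath w ((w, v) # p) r"
  shows "w \<in> children T v"
proof -
  have "v \<in> set (awalk_verts w ((w, v) # p))"
    using assms hd_in_awalk_verts(2)[of v p r] by (simp add: apath_Cons_iff)
  with assms arcs_symmetric[OF assms(1)] show ?thesis
    unfolding children_def neighbours_def awalk_verts_with_proj_eq by blast
qed

lemma children_parent_unique:
  assumes "w \<in> children T u" "w \<in> children T v"
  shows "u = v"
  using assms parent_unique by (elim childrenE) blast

section \<open>Distance to the root and parents\<close>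

definition depth :: "'n \<Rightarrow> nat" where
  "depth w = (LEAST n. \<exists>p. apath w p r \<and> length p = n)"

lemma apath_to_root:
  assumes "w \<in> pverts G"
  shows "\<exists>p. apath w p r"
proof -
  have "strongly_connected (with_proj G)"
    using undirected_tree sym_arcs by (intro symmetric_connected_imp_strongly_connected)
      (auto simp: undirected_tree_def)
  then have "w \<rightarrow>\<^sup>*\<^bsub>with_proj G\<^esub> r"
    using assms root_in_verts by (auto simp: strongly_connected_def)
  then show ?thesis by (simp add: reachable_apath)
qed

text \<open>The second vertex of a shortest path to the root is a parent; the rest of that path
  bounds its depth.\<close>

lemma parent_exists:
  assumes "w \<in> pverts G" "w \<noteq> r"
  shows "\<exists>v \<in> pverts G. w \<in> children T v \<and> depth v < depth w"
proof -
  have "\<exists>p. apath w p r \<and> length p = depth w"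
    unfolding depth_def by (rule LeastI_ex) (use apath_to_root[OF assms(1)] in blast)
  then obtain p where p: "apath w p r" "length p = depth w" by blast
  with assms(2) obtain e p' where e: "p = e # p'"
    by (cases p) (simp_all add: apath_Nil_iff)
  moreover obtain v where "e = (w, v)"
    using p(1) e by (cases e) (simp add: apath_Cons_iff)
  ultimately have *: "(w, v) \<in> parcs G" "apath w ((w, v) # p') r" "apath v p' r" "length p' < depth w"
    using p by (simp_all add: apath_Cons_iff)
  then have "depth v \<le> length p'"
    unfolding depth_def by (blast intro: Least_le)
  with *(4) have "depth v < depth w" by simp
  then show ?thesis
    using childI[OF *(1,2)] in_arcsD2[OF *(1)] by blast
qed

lemma child_in_verts:
  assumes "w \<in> children T v"
  shows "w \<in> pverts G" "v \<in> pverts G"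
  using assms by (auto elim!: childrenE intro: in_arcsD1)

text \<open>By uniqueness, the given parent is the one found by \<open>parent_exists\<close>. Depth
  is thus a rank function that rules out cycles of the child relation.\<close>

lemma depth_child:
  assumes "w \<in> children T v"
  shows "depth v < depth w"
  using assms parent_exists children_parent_unique child_in_verts by (metis childrenE)

text \<open>The only neighbour of a leaf is its parent, which exists as a leaf is not the root. A
  child would be that same neighbour, against the order of depths.\<close>

lemma leaf_no_children:
  assumes "v \<in> leaves T"
  shows "children T v = {}"
proof (rule ccontr)
  assume "children T v \<noteq> {}"
  then obtain w where w: "w \<in> children T v" by blast
  have v: "v \<in> pverts G" "v \<noteq> r" "card (neighbours T v) = 1"
    using assms by (auto simp: leaves_def)
  then obtain u where u: "v \<in> children T u" using parent_exists by blast
  have "u \<in> neighbours T v" "w \<in> neighbours T v"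
    using u w by (auto elim!: childrenE simp: neighbours_def)
  with v(3) have "u = w" by (auto simp: card_1_singleton_iff)
  with u w depth_child show False by (meson less_asym)
qed

section \<open>Descendants and subtrees\<close>

definition child_rel :: "('n \<times> 'n) set" where
  "child_rel = {(a, b). b \<in> children T a}"

lemma descendant_iff: "descendant T w v \<longleftrightarrow> (v, w) \<in> child_rel\<^sup>+"
  by (simp add: descendant_def child_rel_def)

lemma depth_trancl: "(v, w) \<in> child_rel\<^sup>+ \<Longrightarrow> depth v < depth w"
  by (induction rule: trancl_induct) (auto simp: child_rel_def dest: depth_child)

definition subtree :: "'n \<Rightarrow> 'n set" where
  "subtree v = {w. (v, w) \<in> child_rel\<^sup>*}"

lemma subtree_rec: "subtree v = insert v (\<Union>c\<in>children T v. subtree c)"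
  by (auto simp: subtree_def child_rel_def elim: converse_rtranclE
      intro: converse_rtrancl_into_rtrancl)

lemma subtree_self: "v \<in> subtree v"
  by (simp add: subtree_def)

lemma depth_subtree: "w \<in> subtree v \<Longrightarrow> depth v \<le> depth w"
  by (auto simp: subtree_def rtrancl_eq_or_trancl dest: depth_trancl)

lemma not_in_child_subtree: "c \<in> children T v \<Longrightarrow> v \<notin> subtree c"
  using depth_child depth_subtree by fastforce

lemma descendant_iff_subtree: "descendant T w v \<longleftrightarrow> (\<exists>c\<in>children T v. w \<in> subtree c)"
  by (auto simp: descendant_iff subtree_def child_rel_def trancl_unfold_left relcomp_unfold)

text \<open>The ancestors of a node form a chain: going up from \<open>w\<close>, both paths must
  use the same unique parent.\<close>

lemma subtree_comparable:
  assumes "w \<in> subtree a" "w \<in> subtree b"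
  shows "a \<in> subtree b \<or> b \<in> subtree a"
proof -
  have "(a, w) \<in> child_rel\<^sup>*" "(b, w) \<in> child_rel\<^sup>*"
    using assms by (auto simp: subtree_def)
  then show ?thesis
  proof (induction arbitrary: b rule: rtrancl_induct)
    case base
    then show ?case by (auto simp: subtree_def)
  next
    case (step y z)
    from \<open>(b, z) \<in> child_rel\<^sup>*\<close> show ?case
    proof (cases rule: rtranclE)
      case base
      with step.hyps show ?thesis by (auto simp: subtree_def intro: rtrancl_into_rtrancl)
    next
      case (step y')
      with \<open>(y, z) \<in> child_rel\<close> have "y' = y"
        by (auto simp: child_rel_def intro: children_parent_unique)
      with step(1) show ?thesis by (intro step.IH) simp
    qed
  qed
qed

text \<open>A common node would make the two siblings comparable. The lower one has \<open>v\<close>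
  as its only parent, so \<open>v\<close> would lie below its own child.\<close>

lemma sibling_subtrees_disjoint:
  assumes "a \<in> children T v" "b \<in> children T v" "a \<noteq> b"
  shows "subtree a \<inter> subtree b = {}"
proof -
  have *: "x = y" if "x \<in> children T v" "y \<in> children T v" "x \<in> subtree y" for x y
  proof -
    from that(3) have "(y, x) \<in> child_rel\<^sup>*" by (simp add: subtree_def)
    then show ?thesis
    proof (cases rule: rtranclE)
      case (step u)
      with that(1) have "u = v"
        by (auto simp: child_rel_def intro: children_parent_unique)
      with step have "v \<in> subtree y" by (simp add: subtree_def)
      with not_in_child_subtree that(2) show ?thesis by blast
    qed simp
  qed
  show ?thesis
    using subtree_comparable *[of a b] *[of b a] assms by blast
qed

lemma subtree_subset_verts:
  assumes "v \<in> pverts G"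
  shows "subtree v \<subseteq> pverts G"
proof
  fix w assume "w \<in> subtree v"
  then have "(v, w) \<in> child_rel\<^sup>*" by (simp add: subtree_def)
  then show "w \<in> pverts G"
    using assms by (induction rule: rtrancl_induct) (auto simp: child_rel_def child_in_verts)
qed

lemma subtree_root: "subtree r = pverts G"
proof
  show "subtree r \<subseteq> pverts G"
    by (rule subtree_subset_verts[OF root_in_verts])
  show "pverts G \<subseteq> subtree r"
  proof
    fix w assume "w \<in> pverts G"
    then show "w \<in> subtree r"
    proof (induction "depth w" arbitrary: w rule: less_induct)
      case less
      show ?case
      proof (cases "w = r")
        case False
        with less obtain v where "v \<in> subtree r" "w \<in> children T v"
          using parent_exists by meson
        then show ?thesis
          by (auto simp: subtree_def child_rel_def intro: rtrancl_into_rtrancl)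
      qed (simp add: subtree_self)
    qed
  qed
qed

text \<open>Induction from the children to the parent, following the recursion of
  \<open>Valuator\<close>.\<close>

lemma wf_child_rel: "wf (child_rel\<inverse>)"
proof (rule finite_acyclic_wf_converse)
  show "finite child_rel"
    by (rule finite_subset[OF _ pair_finite_arcs]) (auto simp: child_rel_def children_def neighbours_def)
  show "acyclic child_rel"
    using depth_trancl by (auto simp: acyclic_def)
qed

lemma finite_children: "finite (children T v)"
  using pair_finite_verts child_in_verts(1) by (meson finite_subset subsetI)

end

section \<open>Projections of pseudo-Boolean functions\<close>

text \<open>
  All functions of the algorithm depend only on the values of their variables, even outside
  \<^term>\<open>assignments (pb_vars f)\<close>. Hence the restrictions in the joins and derivative signs can be
  dropped.
\<close>

definition local_pbf :: "'v pbf \<Rightarrow> bool" where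
  "local_pbf f \<longleftrightarrow>
    (\<forall>\<tau> \<tau>'. (\<forall>x\<in>pb_vars f. \<tau> x = \<tau>' x) \<longrightarrow> pb_val f \<tau> = pb_val f \<tau>')"

lemma local_pbfD:
  "local_pbf f \<Longrightarrow> (\<And>x. x \<in> pb_vars f \<Longrightarrow> \<tau> x = \<tau>' x) \<Longrightarrow> pb_val f \<tau> = pb_val f \<tau>'"
  unfolding local_pbf_def by blast

section \<open>Locality\<close>

lemma lit_holds_cong: "\<tau> (lit_var l) = \<tau>' (lit_var l) \<Longrightarrow> lit_holds \<tau> l \<longleftrightarrow> lit_holds \<tau>' l"
  by (cases l) auto

lemma clause_holds_cong:
  assumes "\<And>x. x \<in> clause_vars c \<Longrightarrow> \<tau> x = \<tau>' x"
  shows "(\<exists>l\<in>c. lit_holds \<tau> l) \<longleftrightarrow> (\<exists>l\<in>c. lit_holds \<tau>' l)"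
proof (rule bex_cong[OF refl])
  fix l assume "l \<in> c"
  then show "lit_holds \<tau> l \<longleftrightarrow> lit_holds \<tau>' l"
    by (intro lit_holds_cong assms) (simp add: clause_vars_def)
qed

lemma local_clause_pb: "local_pbf (clause_pb c)"
  unfolding local_pbf_def clause_pb_def pbf.simps
  by (intro allI impI arg_cong[where f = of_bool] clause_holds_cong) blast

lemma local_cnf_pb: "local_pbf (cnf_pb \<phi>)"
proof -
  have "(\<forall>c\<in>\<phi>. \<exists>l\<in>c. lit_holds \<tau> l) \<longleftrightarrow> (\<forall>c\<in>\<phi>. \<exists>l\<in>c. lit_holds \<tau>' l)"
    if "\<forall>x\<in>cnf_vars \<phi>. \<tau> x = \<tau>' x" for \<tau> \<tau>'
  proof (rule ball_cong[OF refl])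
    fix c assume "c \<in> \<phi>"
    with that have "\<tau> x = \<tau>' x" if "x \<in> clause_vars c" for x
      using that by (auto simp: cnf_vars_def)
    then show "(\<exists>l\<in>c. lit_holds \<tau> l) \<longleftrightarrow> (\<exists>l\<in>c. lit_holds \<tau>' l)"
      by (rule clause_holds_cong)
  qed
  then show ?thesis
    unfolding local_pbf_def cnf_pb_def pbf.simps by (intro allI impI arg_cong[where f = of_bool])
qed

lemma local_exist_proj:
  assumes "local_pbf f"
  shows "local_pbf (exist_proj x f)"
  unfolding local_pbf_def
proof (intro allI impI)
  fix \<tau> \<tau>' :: "'a assignment"
  assume "\<forall>y\<in>pb_vars (exist_proj x f). \<tau> y = \<tau>' y"
  then have "pb_val f (\<tau>(x \<mapsto> b)) = pb_val f (\<tau>'(x \<mapsto> b))" for b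
    by (intro local_pbfD[OF assms]) (simp add: exist_proj_def)
  then show "pb_val (exist_proj x f) \<tau> = pb_val (exist_proj x f) \<tau>'"
    by (simp add: exist_proj_def)
qed

lemma local_random_proj:
  assumes "local_pbf f"
  shows "local_pbf (random_proj p x f)"
  unfolding local_pbf_def
proof (intro allI impI)
  fix \<tau> \<tau>' :: "'a assignment"
  assume "\<forall>y\<in>pb_vars (random_proj p x f). \<tau> y = \<tau>' y"
  then have "pb_val f (\<tau>(x \<mapsto> b)) = pb_val f (\<tau>'(x \<mapsto> b))" for b
    by (intro local_pbfD[OF assms]) (simp add: random_proj_def)
  then show "pb_val (random_proj p x f) \<tau> = pb_val (random_proj p x f) \<tau>'"
    by (simp add: random_proj_def)
qed

lemma local_pb_join: "local_pbf (pb_join f g)"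
  unfolding local_pbf_def
proof (intro allI impI)
  fix \<tau> \<tau>' :: "'a assignment"
  assume "\<forall>x\<in>pb_vars (pb_join f g). \<tau> x = \<tau>' x"
  then have "\<tau> |` pb_vars f = \<tau>' |` pb_vars f" "\<tau> |` pb_vars g = \<tau>' |` pb_vars g"
    by (auto simp: restrict_map_def fun_eq_iff pb_join_def)
  then show "pb_val (pb_join f g) \<tau> = pb_val (pb_join f g) \<tau>'"
    by (simp add: pb_join_def)
qed

lemma pb_val_join:
  assumes "local_pbf f" "local_pbf g"
  shows "pb_val (pb_join f g) \<tau> = pb_val f \<tau> * pb_val g \<tau>"
  using local_pbfD[OF assms(1), of "\<tau> |` pb_vars f" \<tau>] local_pbfD[OF assms(2), of "\<tau> |` pb_vars g" \<tau>]
  by (simp add: pb_join_def)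

lemma pb_vars_projs [simp]:
  "pb_vars (exist_proj x f) = pb_vars f - {x}"
  "pb_vars (random_proj p x f) = pb_vars f - {x}"
  "pb_vars (pb_join f g) = pb_vars f \<union> pb_vars g"
  "pb_vars (cnf_pb \<phi>) = cnf_vars \<phi>"
  "pb_vars (clause_pb c) = clause_vars c"
  "pb_vars pb_one = {}"
  by (simp_all add: exist_proj_def random_proj_def pb_join_def cnf_pb_def clause_pb_def pb_one_def)

section \<open>Iterated projections\<close>

lemma random_projs_empty [simp]: "random_projs pr {} f = f"
  by (simp add: random_projs_def)

lemma random_projs_insert:
  assumes "finite S" "x \<notin> S"
  shows "random_projs pr (insert x S) f = random_proj (pr x) x (random_projs pr S f)"
proof -
  interpret comp_fun_commute "(\<lambda>x. random_proj (pr x) x)"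
    by (rule random_proj_commute)
  show ?thesis
    using assms by (simp add: random_projs_def)
qed

lemma exist_projs_empty [simp]: "exist_projs {} f = f"
  by (simp add: exist_projs_def)

lemma exist_projs_insert:
  assumes "finite S" "x \<notin> S"
  shows "exist_projs (insert x S) f = exist_proj x (exist_projs S f)"
proof -
  interpret comp_fun_commute "exist_proj"
    by (rule exist_proj_commute)
  show ?thesis
    using assms by (simp add: exist_projs_def)
qed

lemma pb_vars_random_projs [simp]: "finite S \<Longrightarrow> pb_vars (random_projs pr S f) = pb_vars f - S"
  by (induction S rule: finite_induct) (auto simp: random_projs_insert)

lemma local_random_projs: "finite S \<Longrightarrow> local_pbf f \<Longrightarrow> local_pbf (random_projs pr S f)"
  by (induction S rule: finite_induct) (auto simp: random_projs_insert local_random_proj)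

lemma random_projs_nonneg:
  assumes "finite S" "\<And>\<tau>. 0 \<le> pb_val f \<tau>" "\<And>x. x \<in> S \<Longrightarrow> 0 \<le> pr x \<and> pr x \<le> 1"
  shows "0 \<le> pb_val (random_projs pr S f) \<tau>"
  using assms
  by (induction S arbitrary: \<tau> rule: finite_induct)
    (auto simp: random_projs_insert random_proj_def)

text \<open>A factor without the averaged variables is constant under the average. The product is
  given pointwise through \<open>h\<close>, so that \<open>h\<close> may also be the function of a
  CNF.\<close>

lemma random_projs_mult_right:
  assumes "finite S" "local_pbf g" "S \<inter> pb_vars g = {}"
    and "\<And>\<tau>. pb_val h \<tau> = pb_val f \<tau> * pb_val g \<tau>"
  shows "pb_val (random_projs pr S h) \<tau> = pb_val (random_projs pr S f) \<tau> * pb_val g \<tau>"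
  using assms(1,3)
proof (induction S arbitrary: \<tau> rule: finite_induct)
  case (insert x S)
  have "pb_val g (\<tau>(x \<mapsto> b)) = pb_val g \<tau>" for b
    using insert.prems by (intro local_pbfD[OF assms(2)]) auto
  with insert show ?case
    by (simp add: random_projs_insert random_proj_def algebra_simps)
qed (simp add: assms(4))

lemma random_projs_union:
  assumes "finite S" "finite S'" "S \<inter> S' = {}"
  shows "random_projs pr (S \<union> S') f = random_projs pr S (random_projs pr S' f)"
  using assms by (induction S rule: finite_induct) (auto simp: random_projs_insert)

text \<open>The expectation of a product of independent factors: averaging over \<open>S'\<close>
  passes by \<open>f\<close>, then averaging over \<open>S\<close> passes by the averaged
  \<open>g\<close>.\<close>

lemma random_projs_mult:
  assumes "finite S" "finite S'" "S \<inter> S' = {}" "local_pbf f" "local_pbf g"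
    and "S \<inter> pb_vars g = {}" "S' \<inter> pb_vars f = {}"
    and "\<And>\<tau>. pb_val h \<tau> = pb_val f \<tau> * pb_val g \<tau>"
  shows "pb_val (random_projs pr (S \<union> S') h) \<tau>
    = pb_val (random_projs pr S f) \<tau> * pb_val (random_projs pr S' g) \<tau>"
proof -
  have "pb_val (random_projs pr S' h) \<tau> = pb_val f \<tau> * pb_val (random_projs pr S' g) \<tau>" for \<tau>
    using random_projs_mult_right[of S' f h g pr \<tau>] assms by (simp add: mult.commute)
  then show ?thesis
    using assms unfolding random_projs_union[OF assms(1-3)]
    by (intro random_projs_mult_right local_random_projs) auto
qed

text \<open>With \<open>exist_projs_attained\<close>, this identifies the iterated binary maximum
  with the maximum over all assignments for \<open>S\<close>.\<close>

lemma exist_projs_upper: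
  assumes "finite S" "dom \<rho> = S"
  shows "pb_val f (\<tau> ++ \<rho>) \<le> pb_val (exist_projs S f) \<tau>"
  using assms
proof (induction S arbitrary: \<tau> \<rho> rule: finite_induct)
  case (insert x S)
  then obtain b where b: "\<rho> x = Some b" by blast
  have "\<tau> ++ \<rho> = \<tau>(x \<mapsto> b) ++ \<rho>(x := None)"
    using b by (auto simp: map_add_def fun_eq_iff split: option.split)
  moreover have "dom (\<rho>(x := None)) = S"
    using insert by auto
  ultimately have "pb_val f (\<tau> ++ \<rho>) \<le> pb_val (exist_projs S f) (\<tau>(x \<mapsto> b))"
    using insert.IH[of "\<rho>(x := None)" "\<tau>(x \<mapsto> b)"] by (simp only:)
  with insert.hyps show ?case
    by (cases b) (auto simp: exist_projs_insert exist_proj_def)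
qed simp

lemma exist_projs_attained:
  assumes "finite S"
  shows "\<exists>\<rho>. dom \<rho> = S \<and> pb_val f (\<tau> ++ \<rho>) = pb_val (exist_projs S f) \<tau>"
  using assms
proof (induction S arbitrary: \<tau> rule: finite_induct)
  case (insert x S)
  have "\<exists>b. pb_val (exist_projs (insert x S) f) \<tau> = pb_val (exist_projs S f) (\<tau>(x \<mapsto> b))"
    using insert.hyps by (auto simp: exist_projs_insert exist_proj_def max_def)
  then obtain b where b: "pb_val (exist_projs (insert x S) f) \<tau> = pb_val (exist_projs S f) (\<tau>(x \<mapsto> b))"
    by blast
  obtain \<rho> where \<rho>: "dom \<rho> = S" "pb_val f (\<tau>(x \<mapsto> b) ++ \<rho>) = pb_val (exist_projs S f) (\<tau>(x \<mapsto> b))"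
    using insert.IH by blast
  have "dom ([x \<mapsto> b] ++ \<rho>) = insert x S" "\<tau> ++ ([x \<mapsto> b] ++ \<rho>) = \<tau>(x \<mapsto> b) ++ \<rho>"
    using \<rho>(1) by (auto simp: map_add_assoc)
  with \<rho>(2) b show ?case by metis
qed (auto intro: exI[of _ Map.empty])

text \<open>Allows the stack segments of different calls to be analysed separately.\<close>

lemma unwind_append: "unwind (\<sigma> @ \<sigma>') \<tau> = Option.bind (unwind \<sigma> \<tau>) (unwind \<sigma>')"
  by (induction \<sigma> \<tau> rule: unwind.induct) auto

section \<open>The invariant of the valuator\<close>

locale er_projection =
  fixes X Y :: "'v set" and pr :: "'v \<Rightarrow> real"
  assumes disjoint: "X \<inter> Y = {}"
    and pr_bounds: "\<forall>y\<in>Y. 0 \<le> pr y \<and> pr y \<le> 1"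
begin

text \<open>The function \<open>H\<close> of the overview. The variables in
  \<open>P \<inter> X\<close> stay free here; the maximum over them is taken in
  \<open>solves\<close>.\<close>

definition objective :: "'v set \<Rightarrow> 'v cnf \<Rightarrow> 'v assignment \<Rightarrow> real" where
  "objective P \<phi> = pb_val (random_projs pr (P \<inter> Y) (cnf_pb \<phi>))"

text \<open>Random projections are convex combinations. Nonnegativity is what allows maxima to be
  multiplied at a join.\<close>

lemma objective_nonneg: "finite P \<Longrightarrow> 0 \<le> objective P \<phi> \<tau>"
  unfolding objective_def using pr_bounds
  by (intro random_projs_nonneg) (auto simp: cnf_pb_def)

lemma objective_cong:
  assumes "finite P" "\<And>x. x \<in> cnf_vars \<phi> - P \<inter> Y \<Longrightarrow> \<tau> x = \<tau>' x"
  shows "objective P \<phi> \<tau> = objective P \<phi> \<tau>'"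
  unfolding objective_def using assms
  by (intro local_pbfD[OF local_random_projs[OF _ local_cnf_pb]]) auto

text \<open>Indicators of clause sets multiply under union, and each block of averaged variables
  occurs in only one of the factors.\<close>

lemma objective_mult:
  assumes "finite P" "finite P'" "P \<inter> P' = {}"
    and "P \<inter> cnf_vars \<phi>' = {}" "P' \<inter> cnf_vars \<phi> = {}"
  shows "objective (P \<union> P') (\<phi> \<union> \<phi>') \<tau> = objective P \<phi> \<tau> * objective P' \<phi>' \<tau>"
  unfolding objective_def Int_Un_distrib2 using assms
  by (intro random_projs_mult local_cnf_pb) (auto simp: cnf_pb_def cnf_vars_def)

text \<open>
  The condition \<open>\<delta> = []\<close> is needed since a random projection shrinks \<open>pb_vars f\<close>, and the derivative
  signs in \<open>\<delta>\<close> would no longer be evaluated inside their domains.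
\<close>

definition solves :: "'v set \<Rightarrow> 'v cnf \<Rightarrow> 'v pbf \<Rightarrow> 'v dsign list \<Rightarrow> bool" where
  "solves P \<phi> f \<delta> \<longleftrightarrow>
    finite P \<and> local_pbf f \<and> pb_vars f \<subseteq> cnf_vars \<phi> - P \<and> (P \<inter> X = {} \<longrightarrow> \<delta> = []) \<and>
    (\<forall>\<tau> \<rho>. dom \<rho> = P \<inter> X \<longrightarrow> objective P \<phi> (\<tau> ++ \<rho>) \<le> pb_val f \<tau>) \<and>
    (\<forall>\<tau>. pb_vars f \<subseteq> dom \<tau> \<longrightarrow>
      (\<exists>\<rho>. dom \<rho> = P \<inter> X \<and> unwind \<delta> \<tau> = Some (\<tau> ++ \<rho>) \<and>
        objective P \<phi> (\<tau> ++ \<rho>) = pb_val f \<tau>))"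

lemma solves_upper:
  "solves P \<phi> f \<delta> \<Longrightarrow> dom \<rho> = P \<inter> X \<Longrightarrow> objective P \<phi> (\<tau> ++ \<rho>) \<le> pb_val f \<tau>"
  unfolding solves_def by blast

lemma solves_attained:
  assumes "solves P \<phi> f \<delta>" "pb_vars f \<subseteq> dom \<tau>"
  obtains \<rho> where "dom \<rho> = P \<inter> X" "unwind \<delta> \<tau> = Some (\<tau> ++ \<rho>)"
    "objective P \<phi> (\<tau> ++ \<rho>) = pb_val f \<tau>"
  using assms unfolding solves_def by blast

lemma solvesD:
  assumes "solves P \<phi> f \<delta>"
  shows "finite P" "local_pbf f" "pb_vars f \<subseteq> cnf_vars \<phi> - P" "P \<inter> X = {} \<Longrightarrow> \<delta> = []"
  using assms unfolding solves_def by blast+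

section \<open>Preservation of the invariant\<close>

lemma solves_clause: "solves {} {c} (clause_pb c) []"
proof -
  have "pb_val (cnf_pb {c}) = pb_val (clause_pb c)"
    by (simp add: cnf_pb_def clause_pb_def)
  then show ?thesis
    by (simp add: solves_def local_clause_pb objective_def cnf_vars_def)
qed

lemma solves_one: "solves {} {} pb_one []"
  by (auto simp: solves_def local_pbf_def objective_def cnf_pb_def pb_one_def)

text \<open>Nonnegative functions of separate variables are maximised independently. The right
  operand is evaluated later, so its segment \<open>\<delta>'\<close> lies on top of
  \<open>\<delta>\<close>.\<close>

lemma solves_join:
  assumes f: "solves P \<phi> f \<delta>" and g: "solves P' \<phi>' g \<delta>'"
    and disj: "P \<inter> P' = {}" "P \<inter> cnf_vars \<phi>' = {}" "P' \<inter> cnf_vars \<phi> = {}"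
  shows "solves (P \<union> P') (\<phi> \<union> \<phi>') (pb_join f g) (\<delta>' @ \<delta>)"
proof -
  have fin: "finite P" "finite P'" and loc: "local_pbf f" "local_pbf g"
    using f g by (auto dest: solvesD)
  note mult = objective_mult[OF fin disj] and val = pb_val_join[OF loc]
  have bound: "objective (P \<union> P') (\<phi> \<union> \<phi>') (\<tau> ++ \<rho>) \<le> pb_val (pb_join f g) \<tau>"
    if \<rho>: "dom \<rho> = (P \<union> P') \<inter> X" for \<tau> \<rho>
  proof -
    \<comment> \<open>The part of \<open>\<rho>\<close> on \<open>P'\<close> is irrelevant, as
      \<open>\<phi>\<close> contains no variable of \<open>P'\<close>.\<close>
    have "objective P \<phi> (\<tau> ++ \<rho>) = objective P \<phi> (\<tau> ++ \<rho> |` P)"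
      using disj \<rho> by (intro objective_cong fin) (auto simp: map_add_def restrict_map_def split: option.split)
    also have "\<dots> \<le> pb_val f \<tau>"
      using \<rho> by (intro solves_upper[OF f]) auto
    finally have 1: "objective P \<phi> (\<tau> ++ \<rho>) \<le> pb_val f \<tau>" .
    have "objective P' \<phi>' (\<tau> ++ \<rho>) = objective P' \<phi>' (\<tau> ++ \<rho> |` P')"
      using disj \<rho> by (intro objective_cong fin) (auto simp: map_add_def restrict_map_def split: option.split)
    also have "\<dots> \<le> pb_val g \<tau>"
      using \<rho> by (intro solves_upper[OF g]) auto
    finally have 2: "objective P' \<phi>' (\<tau> ++ \<rho>) \<le> pb_val g \<tau>" .
    have "0 \<le> pb_val f \<tau>"
      using 1 objective_nonneg[OF fin(1), of \<phi> "\<tau> ++ \<rho>"] by linarith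
    with 1 2 show ?thesis
      unfolding mult val by (intro mult_mono objective_nonneg fin)
  qed
  have attained: "\<exists>\<rho>. dom \<rho> = (P \<union> P') \<inter> X \<and> unwind (\<delta>' @ \<delta>) \<tau> = Some (\<tau> ++ \<rho>) \<and>
      objective (P \<union> P') (\<phi> \<union> \<phi>') (\<tau> ++ \<rho>) = pb_val (pb_join f g) \<tau>"
    if \<tau>: "pb_vars (pb_join f g) \<subseteq> dom \<tau>" for \<tau>
  proof -
    \<comment> \<open>The top segment \<open>\<delta>'\<close> is popped first;
      \<open>\<delta>\<close> then starts from the extended assignment
      \<open>\<tau> ++ \<rho>'\<close>.\<close>
    obtain \<rho>' where \<rho>': "dom \<rho>' = P' \<inter> X" "unwind \<delta>' \<tau> = Some (\<tau> ++ \<rho>')"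
      "objective P' \<phi>' (\<tau> ++ \<rho>') = pb_val g \<tau>"
      using solves_attained[OF g] \<tau> by auto
    have "pb_vars f \<subseteq> dom (\<tau> ++ \<rho>')" using \<tau> by auto
    then obtain \<rho> where \<rho>: "dom \<rho> = P \<inter> X" "unwind \<delta> (\<tau> ++ \<rho>') = Some (\<tau> ++ \<rho>' ++ \<rho>)"
      "objective P \<phi> (\<tau> ++ \<rho>' ++ \<rho>) = pb_val f (\<tau> ++ \<rho>')"
      using solves_attained[OF f] by blast
    \<comment> \<open>\<open>\<rho>'\<close> assigns only variables of \<open>P'\<close>, none of
      which is a variable of \<open>f\<close>.\<close>
    have "pb_val f (\<tau> ++ \<rho>') = pb_val f \<tau>"
      using solvesD(3)[OF f] \<rho>'(1) disj
      by (intro local_pbfD[OF loc(1)] map_add_dom_app_simps) auto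
    moreover have "objective P' \<phi>' (\<tau> ++ \<rho>' ++ \<rho>) = objective P' \<phi>' (\<tau> ++ \<rho>')"
      using \<rho>(1) disj by (intro objective_cong fin map_add_dom_app_simps) auto
    ultimately have "objective (P \<union> P') (\<phi> \<union> \<phi>') (\<tau> ++ (\<rho>' ++ \<rho>)) = pb_val (pb_join f g) \<tau>"
      using \<rho> \<rho>' by (simp add: mult val)
    moreover have "dom (\<rho>' ++ \<rho>) = (P \<union> P') \<inter> X"
      using \<rho>(1) \<rho>'(1) by auto
    ultimately show ?thesis
      using \<rho>(2) \<rho>'(2) by (intro exI[of _ "\<rho>' ++ \<rho>"]) (simp add: unwind_append)
  qed
  have "pb_vars (pb_join f g) \<subseteq> cnf_vars (\<phi> \<union> \<phi>') - (P \<union> P')"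
    using solvesD(3)[OF f] solvesD(3)[OF g] disj by (auto simp: cnf_vars_def)
  moreover have "\<delta>' @ \<delta> = []" if "(P \<union> P') \<inter> X = {}"
    using that solvesD(4)[OF f] solvesD(4)[OF g] by auto
  ultimately show ?thesis
    unfolding solves_def using fin bound attained local_pb_join by blast
qed

text \<open>As \<open>x\<close> is not in \<open>Y\<close>, the objective is unchanged. The
  derivative sign selects a bit attaining the binary maximum and is popped before
  \<open>\<delta>\<close>, which then starts with \<open>x\<close> assigned.\<close>

lemma solves_exist:
  assumes f: "solves P \<phi> f \<delta>" and x: "x \<in> X"
  shows "solves (insert x P) \<phi> (exist_proj x f) (dsgn x f # \<delta>)"
proof -
  have fin: "finite P" and loc: "local_pbf f"
    using f by (auto dest: solvesD)
  have "insert x P \<inter> Y = P \<inter> Y"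
    using x disjoint by auto
  then have obj: "objective (insert x P) \<phi> = objective P \<phi>"
    by (simp add: objective_def)
  have bound: "objective P \<phi> (\<tau> ++ \<rho>) \<le> pb_val (exist_proj x f) \<tau>"
    if \<rho>: "dom \<rho> = insert x P \<inter> X" for \<tau> \<rho>
  proof -
    obtain b where b: "\<rho> x = Some b" using \<rho> x by blast
    have "\<tau> ++ \<rho> = \<tau>(x \<mapsto> b) ++ \<rho> |` P"
    proof
      fix y
      show "(\<tau> ++ \<rho>) y = (\<tau>(x \<mapsto> b) ++ \<rho> |` P) y"
        using b \<rho> by (cases "\<rho> y") (auto simp: map_add_def restrict_map_def)
    qed
    moreover have "dom (\<rho> |` P) = P \<inter> X" using \<rho> by auto
    ultimately have "objective P \<phi> (\<tau> ++ \<rho>) \<le> pb_val f (\<tau>(x \<mapsto> b))"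
      using solves_upper[OF f] by simp
    then show ?thesis
      by (cases b) (auto simp: exist_proj_def)
  qed
  have attained: "\<exists>\<rho>. dom \<rho> = insert x P \<inter> X \<and> unwind (dsgn x f # \<delta>) \<tau> = Some (\<tau> ++ \<rho>) \<and>
      objective P \<phi> (\<tau> ++ \<rho>) = pb_val (exist_proj x f) \<tau>"
    if \<tau>: "pb_vars f - {x} \<subseteq> dom \<tau>" for \<tau>
  proof -
    define b where "b \<longleftrightarrow> pb_val f (\<tau>(x \<mapsto> True)) \<ge> pb_val f (\<tau>(x \<mapsto> False))"
    \<comment> \<open>\<open>unwind\<close> passes only a restriction of \<open>\<tau>\<close> to
      the sign; by locality the comparison yields the same bit \<open>b\<close>.\<close>
    have "pb_val f ((\<tau> |` (pb_vars f - {x}))(x \<mapsto> c)) = pb_val f (\<tau>(x \<mapsto> c))" for c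
      by (intro local_pbfD[OF loc]) auto
    then have step: "unwind (dsgn x f # \<delta>) \<tau> = unwind \<delta> (\<tau>(x \<mapsto> b))"
      using \<tau> by (simp add: dsgn_def b_def)
    have "pb_vars f \<subseteq> dom (\<tau>(x \<mapsto> b))" using \<tau> by auto
    then obtain \<rho> where \<rho>: "dom \<rho> = P \<inter> X" "unwind \<delta> (\<tau>(x \<mapsto> b)) = Some (\<tau>(x \<mapsto> b) ++ \<rho>)"
      "objective P \<phi> (\<tau>(x \<mapsto> b) ++ \<rho>) = pb_val f (\<tau>(x \<mapsto> b))"
      using solves_attained[OF f] by blast
    have eq: "\<tau> ++ ([x \<mapsto> b] ++ \<rho>) = \<tau>(x \<mapsto> b) ++ \<rho>"
      by (simp add: map_add_assoc)
    have "pb_val (exist_proj x f) \<tau> = pb_val f (\<tau>(x \<mapsto> b))"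
      by (auto simp: exist_proj_def b_def max_def)
    with \<rho> step show ?thesis
      using x by (intro exI[of _ "[x \<mapsto> b] ++ \<rho>"]) (simp add: eq)
  qed
  have "pb_vars (exist_proj x f) \<subseteq> cnf_vars \<phi> - insert x P"
    using solvesD(3)[OF f] by auto
  then show ?thesis
    unfolding solves_def obj using bound attained x fin local_exist_proj[OF loc] by simp
qed

text \<open>As \<open>P \<inter> X\<close> is empty, no maximum has been taken yet: \<open>f\<close>
  agrees with the objective on assignments covering its variables, and both are averaged over
  \<open>x\<close> alike.\<close>

lemma solves_random:
  assumes f: "solves P \<phi> f \<delta>" and x: "x \<in> Y" "x \<notin> P" and PX: "P \<inter> X = {}"
  shows "solves (insert x P) \<phi> (random_proj (pr x) x f) \<delta>"
proof -
  have fin: "finite P" and loc: "local_pbf f" and \<delta>: "\<delta> = []"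
    using f PX by (auto dest: solvesD)
  \<comment> \<open>The empty map is the only \<open>\<rho>\<close> with domain
    \<open>P \<inter> X\<close>.\<close>
  have le: "objective P \<phi> \<tau> \<le> pb_val f \<tau>" for \<tau>
    using solves_upper[OF f, of Map.empty \<tau>] PX by simp
  have eq: "objective P \<phi> \<tau> = pb_val f \<tau>" if "pb_vars f \<subseteq> dom \<tau>" for \<tau>
    using solves_attained[OF f that] PX by auto
  have p: "0 \<le> pr x" "pr x \<le> 1"
    using x pr_bounds by auto
  have X: "insert x P \<inter> X = {}"
    using x PX disjoint by auto
  have obj: "objective (insert x P) \<phi> \<tau> =
      pr x * objective P \<phi> (\<tau>(x \<mapsto> True)) + (1 - pr x) * objective P \<phi> (\<tau>(x \<mapsto> False))" for \<tau>
    unfolding objective_def using x fin by (simp add: random_projs_insert random_proj_def)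
  have "objective (insert x P) \<phi> \<tau> \<le> pb_val (random_proj (pr x) x f) \<tau>" for \<tau>
    unfolding obj random_proj_def using p le by (simp add: add_mono mult_left_mono)
  moreover have "objective (insert x P) \<phi> \<tau> = pb_val (random_proj (pr x) x f) \<tau>"
    if "pb_vars f - {x} \<subseteq> dom \<tau>" for \<tau>
  proof -
    have "pb_vars f \<subseteq> dom (\<tau>(x \<mapsto> b))" for b
      using that by auto
    then show ?thesis
      unfolding obj random_proj_def using eq by simp
  qed
  moreover have "pb_vars (random_proj (pr x) x f) \<subseteq> cnf_vars \<phi> - insert x P"
    using solvesD(3)[OF f] by auto
  ultimately show ?thesis
    unfolding solves_def X using \<delta> fin local_random_proj[OF loc] by simp
qed

text \<open>The stack is split as \<open>\<delta> @ \<sigma>\<close>: \<open>\<sigma>\<close> is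
  inherited from before the call, and the invariant concerns only the call's own segment.\<close>

lemma solves_fold_exist:
  assumes "solves P \<phi> f \<delta>" "set xs \<subseteq> X"
    and "fold (project_step X pr) xs (f, \<delta> @ \<sigma>) = (f', \<sigma>')"
  shows "\<exists>\<delta>'. \<sigma>' = \<delta>' @ \<sigma> \<and> solves (P \<union> set xs) \<phi> f' \<delta>'"
  using assms
proof (induction xs arbitrary: P f \<delta>)
  case (Cons x xs)
  have "solves (insert x P) \<phi> (exist_proj x f) (dsgn x f # \<delta>)"
    using Cons.prems by (intro solves_exist) auto
  from Cons.IH[OF this] Cons.prems show ?case by simp
qed auto

text \<open>The condition \<open>P \<inter> X = {}\<close> survives each step, since only variables
  of \<open>Y\<close> are added; distinctness ensures that each is averaged once.\<close>

lemma solves_fold_random: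
  assumes "solves P \<phi> f \<delta>" "set xs \<subseteq> Y" "P \<inter> X = {}" "P \<inter> set xs = {}" "distinct xs"
    and "fold (project_step X pr) xs (f, \<delta> @ \<sigma>) = (f', \<sigma>')"
  shows "\<exists>\<delta>'. \<sigma>' = \<delta>' @ \<sigma> \<and> solves (P \<union> set xs) \<phi> f' \<delta>'"
  using assms
proof (induction xs arbitrary: P f)
  case (Cons x xs)
  have x: "x \<notin> X" using Cons.prems disjoint by auto
  have "solves (insert x P) \<phi> (random_proj (pr x) x f) \<delta>"
    using Cons.prems by (intro solves_random) auto
  from Cons.IH[OF this] Cons.prems x show ?case by simp
qed auto

end

section \<open>Correctness of the algorithm\<close>

locale er_ssat = er_projection X Y pr + rooted_tree T
  for X Y :: "'v set" and pr :: "'v \<Rightarrow> real" and T :: "('n, 'v) pj_tree" +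
  fixes \<phi> :: "'v cnf"
  assumes cnf: "is_cnf \<phi>"
    and vars: "X \<union> Y = cnf_vars \<phi>"
    and pjt: "project_join_tree \<phi> T"
    and graded: "graded X Y T"
begin

section \<open>Projected variables and clauses of a subtree\<close>

definition projected :: "'n \<Rightarrow> 'v set" where
  "projected v = \<Union> (pj_proj T ` (subtree v \<inter> internals T))"

definition clauses :: "'n \<Rightarrow> 'v cnf" where
  "clauses v = pj_clause T ` (subtree v \<inter> leaves T)"

lemma finite_cnf_vars: "finite (cnf_vars \<phi>)"
  using cnf by (auto simp: is_cnf_def cnf_vars_def clause_vars_def)

lemma clause_bij: "bij_betw (pj_clause T) (leaves T) \<phi>"
  and proj_disjoint: "disjoint_family_on (pj_proj T) (internals T)"
  and proj_cover: "(\<Union>v\<in>internals T. pj_proj T v) = cnf_vars \<phi>"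
  using pjt by (auto simp: project_join_tree_def)

text \<open>The condition on \<open>\<pi>\<close> restated for leaves instead of clauses;
  injectivity of \<open>\<gamma>\<close> on leaves cancels its inverse.\<close>

lemma proj_descendant:
  assumes "v \<in> internals T" "x \<in> pj_proj T v" "l \<in> leaves T" "x \<in> clause_vars (pj_clause T l)"
  shows "l \<in> subtree v"
proof -
  have "inj_on (pj_clause T) (leaves T)" "pj_clause T l \<in> \<phi>"
    using clause_bij assms(3) by (auto simp: bij_betw_def)
  then have "descendant T l v"
    using pjt assms the_inv_into_f_f[of "pj_clause T" "leaves T" l]
    unfolding project_join_tree_def by metis
  then show ?thesis
    by (auto simp: descendant_iff subtree_def)
qed

lemma finite_pj_proj: "v \<in> internals T \<Longrightarrow> finite (pj_proj T v)"
  using proj_cover finite_cnf_vars by (auto intro: finite_subset)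

lemma projected_leaf: "v \<in> leaves T \<Longrightarrow> projected v = {}"
  and clauses_leaf: "v \<in> leaves T \<Longrightarrow> clauses v = {pj_clause T v}"
  using leaf_no_children[of v] subtree_rec[of v]
  by (auto simp: projected_def clauses_def internals_def)

lemma projected_internal:
  assumes "v \<in> internals T"
  shows "projected v = pj_proj T v \<union> (\<Union>c\<in>children T v. projected c)"
  using assms by (subst projected_def, subst subtree_rec) (auto simp: projected_def)

lemma clauses_internal:
  assumes "v \<in> internals T"
  shows "clauses v = (\<Union>c\<in>children T v. clauses c)"
  using assms by (subst clauses_def, subst subtree_rec) (auto simp: clauses_def internals_def)

lemma projected_disjoint:
  assumes "subtree a \<inter> subtree b = {}"
  shows "projected a \<inter> projected b = {}"
proof -
  have "x \<notin> pj_proj T w" if "v \<in> subtree a \<inter> internals T" "w \<in> subtree b \<inter> internals T"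
    "x \<in> pj_proj T v" for v w x
    using that assms disjoint_family_onD[OF proj_disjoint, of v w] by blast
  then show ?thesis
    unfolding projected_def by blast
qed

lemma subtree_trans: "w \<in> subtree v \<Longrightarrow> v \<in> subtree u \<Longrightarrow> w \<in> subtree u"
  by (auto simp: subtree_def)

text \<open>All clauses containing a variable projected at a node sit at leaves below that node,
  hence outside any disjoint subtree.\<close>

lemma projected_clauses_disjoint:
  assumes "subtree a \<inter> subtree b = {}"
  shows "projected a \<inter> cnf_vars (clauses b) = {}"
proof -
  have False if "v \<in> subtree a \<inter> internals T" "x \<in> pj_proj T v" "l \<in> subtree b \<inter> leaves T"
    "x \<in> clause_vars (pj_clause T l)" for v x l
    using that proj_descendant[of v x l] subtree_trans[of l v a] assms by blast
  then show ?thesis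
    unfolding projected_def clauses_def cnf_vars_def by blast
qed

lemma proj_disjoint_children:
  assumes "v \<in> internals T" "c \<in> children T v"
  shows "projected c \<inter> pj_proj T v = {}"
proof -
  have "pj_proj T w \<inter> pj_proj T v = {}" if "w \<in> subtree c \<inter> internals T" for w
    using that assms not_in_child_subtree[of c v] by (intro disjoint_family_onD[OF proj_disjoint]) auto
  then show ?thesis
    unfolding projected_def by blast
qed

text \<open>Internal nodes below a node of \<open>IY\<close> are again in \<open>IY\<close>. So a
  node that projects \<open>Y\<close> variables has no \<open>X\<close> variable projected below
  it.\<close>

lemma graded_cases:
  assumes "v \<in> internals T"
  shows "pj_proj T v \<subseteq> X \<or> pj_proj T v \<subseteq> Y \<and> (\<forall>c\<in>children T v. projected c \<subseteq> Y)"
proof -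
  obtain IX IY where I: "IX \<union> IY = internals T" "\<And>v. v \<in> IX \<Longrightarrow> pj_proj T v \<subseteq> X"
    "\<And>v. v \<in> IY \<Longrightarrow> pj_proj T v \<subseteq> Y" "\<And>v w. v \<in> IX \<Longrightarrow> w \<in> IY \<Longrightarrow> \<not> descendant T v w"
    using graded unfolding graded_def by metis
  have "projected c \<subseteq> Y" if "v \<in> IY" "c \<in> children T v" for c
  proof -
    have "w \<in> IY" if "w \<in> subtree c \<inter> internals T" for w
      using that I(1) I(4)[OF _ \<open>v \<in> IY\<close>, of w] \<open>c \<in> children T v\<close>
      unfolding descendant_iff_subtree by blast
    then show ?thesis
      unfolding projected_def using I(3) by blast
  qed
  with I assms show ?thesis by blast
qed

text \<open>Simultaneous induction over runs. The parent \<open>u\<close> in the second claim makes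
  the listed nodes distinct siblings, whose disjoint subtrees give the side conditions of
  \<open>solves_join\<close>.\<close>

lemma valuator_solves:
  "valuator X pr T v \<sigma> f \<sigma>' \<Longrightarrow>
    \<exists>\<delta>. \<sigma>' = \<delta> @ \<sigma> \<and> solves (projected v) (clauses v) f \<delta>"
  "valuators X pr T vs \<sigma> fs \<sigma>' \<Longrightarrow> \<forall>u. distinct vs \<longrightarrow> set vs \<subseteq> children T u \<longrightarrow>
    (\<exists>\<delta>. \<sigma>' = \<delta> @ \<sigma> \<and>
      solves (\<Union>v\<in>set vs. projected v) (\<Union>v\<in>set vs. clauses v) (foldr pb_join fs pb_one) \<delta>)"
proof (induction rule: valuator_valuators.inducts)
  case (leaf v \<sigma>)
  then show ?case
    using solves_clause by (simp add: projected_leaf clauses_leaf)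
next
  case (internal v vs \<sigma> fs \<sigma>' xs f \<sigma>'')
  let ?P = "\<Union>c\<in>children T v. projected c"
  obtain \<delta> where \<delta>: "\<sigma>' = \<delta> @ \<sigma>" "solves ?P (clauses v) (foldr pb_join fs pb_one) \<delta>"
    using internal(4)[rule_format, of v] internal(2,7) by (auto simp: clauses_internal[OF internal(1)])
  have fold: "fold (project_step X pr) xs (foldr pb_join fs pb_one, \<delta> @ \<sigma>) = (f, \<sigma>'')"
    using internal(6) \<delta>(1) by simp
  have P: "projected v = ?P \<union> set xs"
    unfolding projected_internal[OF internal(1)] internal(5) by (rule Un_commute)
  from graded_cases[OF internal(1)] show ?case
  proof
    assume "pj_proj T v \<subseteq> X"
    then show ?thesis
      unfolding P by (intro solves_fold_exist[OF \<delta>(2) _ fold]) (simp add: internal(5))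
  next
    assume *: "pj_proj T v \<subseteq> Y \<and> (\<forall>c\<in>children T v. projected c \<subseteq> Y)"
    \<comment> \<open>Here gradedness enters: everything projected in the subtrees of the children
      is in \<open>Y\<close>.\<close>
    then have "?P \<inter> X = {}"
      using disjoint by blast
    moreover have "?P \<inter> set xs = {}"
      using proj_disjoint_children[OF internal(1)] internal(5) by blast
    ultimately show ?thesis
      unfolding P using internal(5,8) * by (intro solves_fold_random[OF \<delta>(2) _ _ _ _ fold]) simp_all
  qed
next
  case (Nil \<sigma>)
  then show ?case
    using solves_one by simp
next
  case (Cons v \<sigma> f \<sigma>' vs fs \<sigma>'')
  show ?case
  proof (intro allI impI)
    fix u assume prems: "distinct (v # vs)" "set (v # vs) \<subseteq> children T u"
    obtain \<delta> where \<delta>: "\<sigma>' = \<delta> @ \<sigma>" "solves (projected v) (clauses v) f \<delta>"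
      using Cons(2) by blast
    obtain \<delta>' where \<delta>': "\<sigma>'' = \<delta>' @ \<sigma>'" "solves (\<Union>v\<in>set vs. projected v)
        (\<Union>v\<in>set vs. clauses v) (foldr pb_join fs pb_one) \<delta>'"
      using Cons(4)[rule_format, of u] prems by auto
    have disj: "subtree v \<inter> subtree w = {}" "subtree w \<inter> subtree v = {}" if "w \<in> set vs" for w
      using sibling_subtrees_disjoint[of v u w] that prems by auto
    have "solves (projected v \<union> (\<Union>v\<in>set vs. projected v)) (clauses v \<union> (\<Union>v\<in>set vs. clauses v))
        (pb_join f (foldr pb_join fs pb_one)) (\<delta>' @ \<delta>)"
    proof (rule solves_join[OF \<delta>(2) \<delta>'(2)])
      show "projected v \<inter> (\<Union>v\<in>set vs. projected v) = {}"
        using projected_disjoint disj(1) by blast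
      show "projected v \<inter> cnf_vars (\<Union>v\<in>set vs. clauses v) = {}"
        using projected_clauses_disjoint disj(1) unfolding cnf_vars_def by blast
      show "(\<Union>v\<in>set vs. projected v) \<inter> cnf_vars (clauses v) = {}"
        using projected_clauses_disjoint disj(2) by blast
    qed
    with \<delta>(1) \<delta>'(1) show "\<exists>\<delta>. \<sigma>'' = \<delta> @ \<sigma> \<and> solves (\<Union>v\<in>set (v # vs). projected v)
          (\<Union>v\<in>set (v # vs). clauses v) (foldr pb_join (f # fs) pb_one) \<delta>"
      by simp
  qed
qed

text \<open>Guards against vacuity: a claim about all outcomes is informative only if some run
  exists.\<close>

lemma valuator_exists:
  assumes "v \<in> pverts G"
  shows "\<exists>f \<sigma>'. valuator X pr T v \<sigma> f \<sigma>'"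
  using assms
proof (induction v arbitrary: \<sigma> rule: wf_induct_rule[OF wf_child_rel])
  case (1 v)
  show ?case
  proof (cases "v \<in> leaves T")
    case True
    then show ?thesis by (blast intro: valuator_valuators.leaf)
  next
    case False
    with 1 have v: "v \<in> internals T" by (simp add: internals_def)
    have step: "\<exists>f \<sigma>'. valuator X pr T c \<sigma> f \<sigma>'" if "c \<in> children T v" for c \<sigma>
      using that 1(1)[of c \<sigma>] child_in_verts(1)[OF that] by (simp add: child_rel_def)
    have all: "\<exists>fs \<sigma>'. valuators X pr T vs \<sigma> fs \<sigma>'" if "set vs \<subseteq> children T v" for vs
      using that
    proof (induction vs arbitrary: \<sigma>)
      case Nil
      then show ?case by (blast intro: valuator_valuators.Nil)
    next
      case (Cons c vs)
      obtain f \<sigma>' where "valuator X pr T c \<sigma> f \<sigma>'"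
        using step Cons.prems by fastforce
      moreover obtain fs \<sigma>'' where "valuators X pr T vs \<sigma>' fs \<sigma>''"
        using Cons by fastforce
      ultimately show ?case by (blast intro: valuator_valuators.Cons)
    qed
    obtain vs where vs: "set vs = children T v" "distinct vs"
      using finite_distinct_list[OF finite_children] by blast
    obtain xs where xs: "set xs = pj_proj T v" "distinct xs"
      using finite_distinct_list[OF finite_pj_proj[OF v]] by blast
    obtain fs \<sigma>' where fs: "valuators X pr T vs \<sigma> fs \<sigma>'"
      using all vs by blast
    obtain f \<sigma>'' where "fold (project_step X pr) xs (foldr pb_join fs pb_one, \<sigma>') = (f, \<sigma>'')"
      by fastforce
    from valuator_valuators.internal[OF v vs(2,1) fs xs(2,1) this] show ?thesis by blast
  qed
qed

section \<open>Evaluation at the root\<close>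

lemma projected_root: "projected r = cnf_vars \<phi>"
  unfolding projected_def subtree_root using proj_cover by (auto simp: internals_def)

lemma clauses_root: "clauses r = \<phi>"
  unfolding clauses_def subtree_root using clause_bij by (auto simp: bij_betw_def leaves_def)

text \<open>At the root the invariant holds with \<open>P = X \<union> Y\<close>, so
  \<open>f\<close> has no variables left and the empty assignment covers them.\<close>

lemma outcome_correct:
  assumes "valuator X pr T r [] f \<sigma>"
  defines "F \<equiv> random_projs pr Y (cnf_pb \<phi>)"
  shows "pb_vars f = {}"
    and "\<exists>\<tau>. unwind \<sigma> Map.empty = Some \<tau> \<and> dom \<tau> = X \<and> pb_val F \<tau> = pb_val f Map.empty"
    and "pb_val f Map.empty = pb_val (exist_projs X F) Map.empty"
    and "pb_vars F = X"
proof -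
  have f: "solves (X \<union> Y) \<phi> f \<sigma>"
    using valuator_solves(1)[OF assms(1)] by (simp add: projected_root clauses_root vars)
  have P: "(X \<union> Y) \<inter> X = X" "(X \<union> Y) \<inter> Y = Y" by auto
  have F: "objective (X \<union> Y) \<phi> = pb_val F"
    by (simp add: objective_def P F_def)
  have fin: "finite X" "finite Y"
    using finite_cnf_vars by (auto simp flip: vars)
  show "pb_vars F = X"
    using fin vars disjoint by (auto simp: F_def)
  show "pb_vars f = {}"
    using solvesD(3)[OF f] vars by auto
  then obtain \<rho> where \<rho>: "dom \<rho> = X" "unwind \<sigma> Map.empty = Some \<rho>" "pb_val F \<rho> = pb_val f Map.empty"
    using solves_attained[OF f, of Map.empty] by (auto simp: P F)
  then show "\<exists>\<tau>. unwind \<sigma> Map.empty = Some \<tau> \<and> dom \<tau> = X \<and> pb_val F \<tau> = pb_val f Map.empty"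
    by blast
  show "pb_val f Map.empty = pb_val (exist_projs X F) Map.empty"
  \<comment> \<open>Both sides are maxima of \<open>F\<close> over the assignments for
    \<open>X\<close>: each is attained, and each bounds the value attained by the other.\<close>
  proof (rule antisym)
    show "pb_val f Map.empty \<le> pb_val (exist_projs X F) Map.empty"
      using exist_projs_upper[OF fin(1) \<rho>(1), of F Map.empty] \<rho>(3) by simp
    obtain \<rho>' where "dom \<rho>' = X" "pb_val F \<rho>' = pb_val (exist_projs X F) Map.empty"
      using exist_projs_attained[OF fin(1), of F Map.empty] by auto
    then show "pb_val (exist_projs X F) Map.empty \<le> pb_val f Map.empty"
      using solves_upper[OF f, of \<rho>' Map.empty] by (simp add: P F)
  qed
qed

end

theorem theorem2:
  fixes \<phi> :: "'v cnf" and X Y :: "'v set" and pr :: "'v \<Rightarrow> real" and T :: "('n, 'v) pj_tree"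
  assumes "is_cnf \<phi>"
    and "X \<union> Y = cnf_vars \<phi>" and "X \<inter> Y = {}"
    and "\<forall>y\<in>Y. 0 \<le> pr y \<and> pr y \<le> 1"
    and "project_join_tree \<phi> T" and "graded X Y T"
  shows "er_ssat_outcomes X pr T \<noteq> {} \<and>
    (\<forall>out \<in> er_ssat_outcomes X pr T. \<exists>m \<tau>. out = Some (m, \<tau>) \<and>
      m = pb_maximum (random_projs pr Y (cnf_pb \<phi>)) \<and>
      m = pb_val (exist_projs X (random_projs pr Y (cnf_pb \<phi>))) Map.empty \<and>
      \<tau> \<in> assignments X \<and>
      is_maximizer (random_projs pr Y (cnf_pb \<phi>)) \<tau>)"
proof -
  interpret er_ssat X Y pr T \<phi>
    using assms by unfold_locales (auto simp: project_join_tree_def)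
  show ?thesis
  proof (intro conjI ballI)
    show "er_ssat_outcomes X pr T \<noteq> {}"
      using valuator_exists[OF root_in_verts] by (auto simp: er_ssat_outcomes_def)
  next
    fix out assume "out \<in> er_ssat_outcomes X pr T"
    then obtain f \<sigma> where f: "valuator X pr T r [] f \<sigma>"
      and out: "out = (if pb_vars f = {}
        then map_option (Pair (pb_val f Map.empty)) (unwind \<sigma> Map.empty) else None)"
      by (auto simp: er_ssat_outcomes_def)
    from outcome_correct[OF f] out
    show "\<exists>m \<tau>. out = Some (m, \<tau>) \<and>
      m = pb_maximum (random_projs pr Y (cnf_pb \<phi>)) \<and>
      m = pb_val (exist_projs X (random_projs pr Y (cnf_pb \<phi>))) Map.empty \<and>
      \<tau> \<in> assignments X \<and>
      is_maximizer (random_projs pr Y (cnf_pb \<phi>)) \<tau>"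
      by (auto simp: is_maximizer_def pb_maximum_def assignments_def)
  qed
qed

end
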